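(* Let $n \in \mathbb N$ and let $p \in {\rm Pol}(M_n(\mathbb C))$ be a self-adjoint matrix polynomial of degree $d$, with leading form $p^{(d)}$, such that (i) $p^{(d)}$ is non-degenerate, and (ii) the induced map $p^{(d)}_{\mathbb S} \colon {\mathbb S}(M_n(\mathbb C)_{h}) \to {\mathbb S}(M_n(\mathbb C)_{h})$ has non-zero topological degree. Then there exists $X \in M_n(\mathbb C)_{h}$ such that $p(X)=0$.
   Context: Fix $n \in \mathbb N$. $M_n(\mathbb C)$ is the algebra of complex $(n\times n)$-matrices and $M_n(\mathbb C)_h$ is the real vector space of self-adjoint (Hermitian) matrices. The polynomial algebra is the graded unital ring ${\rm Pol}(M_n(\mathbb C)) = \bigoplus_{d=0}^{\infty} M_n(\mathbb C)^{\otimes (d+1)}$ (tensor products over $\mathbb C$; the summand $M_n(\mathbb C)^{\otimes(d+1)}$ is the part of degree $d$), with multiplication $(A_0 \otimes \cdots \otimes A_d)\cdot (B_0 \otimes \cdots \otimes B_{d'})= A_0 \otimes \cdots \otimes A_{d-1} \otimes A_dB_0 \otimes B_1 \otimes \cdots \otimes B_{d'}$. An element is evaluated at $X \in M_n(\mathbb C)$ by linear extension of $(A_0 \otimes \cdots \otimes A_d)(X) = A_0XA_1X \cdots A_{d-1}XA_d$. The degree of a non-zero $p$ is the largest $d$ for which its component in degree $d$ is non-zero (the zero polynomial has degree $-\infty$); this degree is that of the element of ${\rm Pol}(M_n(\mathbb C))$. The leading form $p^{(d)}$ of $p$ of degree $d$ is its component in degree $d$. The involution on ${\rm Pol}(M_n(\mathbb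 C))$ is the conjugate-linear map with $(A_0 \otimes \cdots \otimes A_d)^* = A_d^* \otimes \cdots \otimes A_0^*$; $p$ is self-adjoint if $p^*=p$. Then $p(X)^*=p^*(X^* )$, so a self-adjoint $p$ maps $M_n(\mathbb C)_h$ to itself. A self-adjoint homogeneous $q \in {\rm Pol}(M_n(\mathbb C))$ is non-degenerate if, for $X \in M_n(\mathbb C)_h$, $q(X)=0$ implies $X=0$. Put $\|X\|^2 = \frac1n\sum_{i,j=1}^n |x_{ij}|^2$ and ${\mathbb S}(M_n(\mathbb C)_{h}) = \{X \in M_n(\mathbb C)_{h} : \|X\|=1\}$, a sphere of dimension $n^2-1$. A self-adjoint, homogeneous, non-degenerate $q$ induces the continuous self-map $q_{\mathbb S}(X)=q(X)/\|q(X)\|$ of ${\mathbb S}(M_n(\mathbb C)_{h})$. Topological degree means the Brouwer degree of a continuous self-map of the sphere (for $n=1$, where the sphere is $S^0$, the degree is defined by the action on reduced homology). *)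

theory Defs
  imports "HOL-Analysis.Analysis" "HOL-Homology.Homology" "HOL-Library.Poly_Mapping"
begin

section \<open>Complex matrices\<close>

type_synonym 'n cmat = "complex^'n^'n"

definition cadjoint :: "'n::finite cmat \<Rightarrow> 'n cmat"
  where "cadjoint A = (\<chi> i j. cnj (A $ j $ i))"

definition hermitian :: "'n::finite cmat \<Rightarrow> bool"
  where "hermitian A \<longleftrightarrow> cadjoint A = A"

definition cmat_scale :: "complex \<Rightarrow> 'n::finite cmat \<Rightarrow> 'n cmat"
  where "cmat_scale c A = (\<chi> i j. c * A $ i $ j)"

definition matrix_unit :: "'n \<times> 'n \<Rightarrow> 'n::finite cmat"
  where "matrix_unit a = (\<chi> i j. if (i, j) = a then 1 else 0)"

definition cmat_norm :: "'n::finite cmat \<Rightarrow> real"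
  where "cmat_norm X = sqrt (1 / real CARD('n) * (\<Sum>i\<in>UNIV. \<Sum>j\<in>UNIV. (cmod (X $ i $ j))\<^sup>2))"

section \<open>Matrix polynomials\<close>

text \<open>
  The matrix units form a basis of the algebra of matrices, so the (d+1)-fold tensor power has
  the basis of all tensors of d+1 matrix units.  Such a basis tensor is encoded by the pair of
  its first index pair and the list of its d remaining ones (a nonempty word), and an element of
  the direct sum over all d is the finitely supported family of its coefficients.
  Here \<open>elem_tensor A [B1, ..., Bd]\<close> is the elementary tensor of A, B1, ..., Bd; its coefficients
  are products of matrix entries, hence multilinear in the factors.  The lemmas below show that
  elementary tensors span (\<open>matpol_expand\<close>), and that evaluation and involution are the linear
  and conjugate-linear maps with the usual values on all elementary tensors
  (\<open>mp_eval_elem_tensor\<close>, \<open>mp_star_elem_tensor\<close>).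
\<close>

type_synonym 'n unit_word = "('n \<times> 'n) \<times> ('n \<times> 'n) list"
type_synonym 'n matpol = "'n unit_word \<Rightarrow>\<^sub>0 complex"

lift_definition elem_tensor :: "'n::finite cmat \<Rightarrow> 'n cmat list \<Rightarrow> 'n matpol"
  is "\<lambda>A Bs (a, bs). if length bs = length Bs
        then A $ fst a $ snd a * (\<Prod>k<length Bs. Bs ! k $ fst (bs ! k) $ snd (bs ! k)) else 0"
proof -
  fix A :: "'n cmat" and Bs :: "'n cmat list"
  have "finite {bs :: ('n \<times> 'n) list. length bs = length Bs}"
    using finite_lists_length_eq[of "UNIV :: ('n \<times> 'n) set" "length Bs"] by simp
  then have "finite ((UNIV :: ('n \<times> 'n) set) \<times> {bs :: ('n \<times> 'n) list. length bs = length Bs})"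
    by simp
  then show "finite {x. (case x of (a, bs) \<Rightarrow> if length bs = length Bs
        then A $ fst a $ snd a * (\<Prod>k<length Bs. Bs ! k $ fst (bs ! k) $ snd (bs ! k)) else 0) \<noteq> 0}"
    by (rule rev_finite_subset) (auto split: if_splits)
qed

definition mp_scale :: "complex \<Rightarrow> 'n matpol \<Rightarrow> 'n matpol"
  where "mp_scale c p = Poly_Mapping.map (\<lambda>z. c * z) p"

definition tensor_eval :: "'n::finite cmat \<Rightarrow> 'n cmat \<Rightarrow> 'n cmat list \<Rightarrow> 'n cmat"
  where "tensor_eval X A Bs = foldl (\<lambda>M B. M ** X ** B) A Bs"

definition mp_eval :: "'n::finite matpol \<Rightarrow> 'n cmat \<Rightarrow> 'n cmat"
  where "mp_eval p X = (\<Sum>w\<in>Poly_Mapping.keys p. cmat_scale (Poly_Mapping.lookup p w)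
            (tensor_eval X (matrix_unit (fst w)) (map matrix_unit (snd w))))"

lift_definition mp_component :: "nat \<Rightarrow> 'n matpol \<Rightarrow> 'n matpol"
  is "\<lambda>d p w. if length (snd w) = d then p w else 0"
  by (erule rev_finite_subset) auto

definition mp_degree :: "'n matpol \<Rightarrow> ereal"
  where "mp_degree p = (if p = 0 then -\<infinity> else ereal (real (Max {d. mp_component d p \<noteq> 0})))"

definition word_star :: "'n unit_word \<Rightarrow> 'n unit_word"
  where "word_star w = (let v = rev (map prod.swap (fst w # snd w)) in (hd v, tl v))"

lemma word_star_word_star: "word_star (word_star w) = w"
proof (cases w)
  case (Pair a bs)
  show ?thesis
    by (cases bs rule: rev_cases)
      (simp_all add: word_star_def Let_def Pair rev_map hd_append flip: map_tl)
qed

lemma inj_word_star: "inj word_star"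
  by (metis injI word_star_word_star)

text \<open>The involution reverses the order of the tensor factors and sends each matrix unit
  to its transpose, conjugating the coefficients.\<close>

lift_definition mp_star :: "'n matpol \<Rightarrow> 'n matpol"
  is "\<lambda>p w. cnj (p (word_star w))"
proof -
  fix p :: "'n unit_word \<Rightarrow> complex"
  assume "finite {w. p w \<noteq> 0}"
  then have "finite (word_star -` {w. p w \<noteq> 0})"
    by (rule finite_vimageI[OF _ inj_word_star])
  then show "finite {w. cnj (p (word_star w)) \<noteq> 0}"
    by (simp add: vimage_def)
qed

definition mp_selfadjoint :: "'n matpol \<Rightarrow> bool"
  where "mp_selfadjoint p \<longleftrightarrow> mp_star p = p"

text \<open>The notion is meant for self-adjoint homogeneous q only; components of self-adjoint
  polynomials are such.\<close>

definition mp_nondegenerate :: "'n::finite matpol \<Rightarrow> bool"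
  where "mp_nondegenerate q \<longleftrightarrow> (\<forall>X. hermitian X \<longrightarrow> mp_eval q X = 0 \<longrightarrow> X = 0)"

section \<open>Topological degree\<close>

text \<open>\<^const>\<open>Brouwer_degree2\<close> refers to the standard sphere \<^term>\<open>nsphere m\<close> and is defined
  through reduced homology (also for \<open>m = 0\<close>).  It is transported to a space S homeomorphic to
  the standard sphere; by \<open>sphere_degree_eq\<close> below the result does not depend on the homeomorphism.\<close>

definition sphere_degree :: "nat \<Rightarrow> 'a topology \<Rightarrow> ('a \<Rightarrow> 'a) \<Rightarrow> int"
  where "sphere_degree m S f =
    (THE k. \<exists>h g. homeomorphic_maps (nsphere m) S h g \<and> k = Brouwer_degree2 m (g \<circ> f \<circ> h))"

definition herm_sphere :: "'n::finite cmat topology"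
  where "herm_sphere = top_of_set {X. hermitian X \<and> cmat_norm X = 1}"

definition herm_sphere_degree :: "('n::finite cmat \<Rightarrow> 'n cmat) \<Rightarrow> int"
  where "herm_sphere_degree f = sphere_degree (CARD('n)\<^sup>2 - 1) herm_sphere f"

definition sphere_map :: "'n::finite matpol \<Rightarrow> 'n cmat \<Rightarrow> 'n cmat"
  where "sphere_map q X = (1 / cmat_norm (mp_eval q X)) *\<^sub>R mp_eval q X"

section \<open>Basic properties\<close>

lemma cmat_scale_simps:
  "cmat_scale c A $ i $ j = c * A $ i $ j"
  by (simp add: cmat_scale_def)

lemma mp_eval_superset:
  assumes "finite S" "Poly_Mapping.keys p \<subseteq> S"
  shows "mp_eval p X = (\<Sum>w\<in>S. cmat_scale (Poly_Mapping.lookup p w)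
            (tensor_eval X (matrix_unit (fst w)) (map matrix_unit (snd w))))"
  unfolding mp_eval_def
  by (rule sum.mono_neutral_left)
    (use assms in \<open>auto simp: in_keys_iff cmat_scale_def vec_eq_iff\<close>)

lemma mp_eval_add: "mp_eval (p + q) X = mp_eval p X + mp_eval q X"
proof -
  let ?S = "Poly_Mapping.keys p \<union> Poly_Mapping.keys q"
  have "finite ?S" by simp
  moreover have "Poly_Mapping.keys (p + q) \<subseteq> ?S"
    by (rule Poly_Mapping.keys_add)
  ultimately show ?thesis
    by (simp add: mp_eval_superset[of ?S] flip: sum.distrib)
      (simp add: lookup_add cmat_scale_def vec_eq_iff algebra_simps)
qed

lemma lookup_mp_scale: "Poly_Mapping.lookup (mp_scale c p) w = c * Poly_Mapping.lookup p w"
  by (auto simp: mp_scale_def Poly_Mapping.map.rep_eq when_def)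

lemma cmat_scale_sum: "cmat_scale c (\<Sum>x\<in>S. f x) = (\<Sum>x\<in>S. cmat_scale c (f x))"
  by (simp add: cmat_scale_def vec_eq_iff sum_distrib_left)

lemma cmat_scale_cmat_scale: "cmat_scale c (cmat_scale d A) = cmat_scale (c * d) A"
  by (simp add: cmat_scale_def vec_eq_iff)

lemma mp_eval_scale: "mp_eval (mp_scale c p) X = cmat_scale c (mp_eval p X)"
proof -
  have "Poly_Mapping.keys (mp_scale c p) \<subseteq> Poly_Mapping.keys p"
    by (auto simp: in_keys_iff lookup_mp_scale)
  then have "mp_eval (mp_scale c p) X = (\<Sum>w\<in>Poly_Mapping.keys p.
      cmat_scale (Poly_Mapping.lookup (mp_scale c p) w)
            (tensor_eval X (matrix_unit (fst w)) (map matrix_unit (snd w))))"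
    by (intro mp_eval_superset) auto
  then show ?thesis
    by (simp add: mp_eval_def[of p] cmat_scale_sum cmat_scale_cmat_scale lookup_mp_scale)
qed

lemma matrix_expand: "A = (\<Sum>a\<in>UNIV. cmat_scale (A $ fst a $ snd a) (matrix_unit a))"
proof -
  have "(\<Sum>a\<in>UNIV. A $ fst a $ snd a * (if (i, j) = a then 1 else 0)) = A $ i $ j" for i j
    by (simp add: if_distrib cong: if_cong)
  then show ?thesis
    by (simp add: vec_eq_iff cmat_scale_def matrix_unit_def)
qed

lemma lists_Suc_sum:
  fixes f :: "'a::finite list \<Rightarrow> 'b::comm_monoid_add"
  shows "(\<Sum>bs | length bs = Suc n. f bs) = (\<Sum>b\<in>UNIV. \<Sum>bs | length bs = n. f (b # bs))"
proof -
  have "{bs :: 'a list. length bs = Suc n} = (\<lambda>(b, bs). b # bs) ` (UNIV \<times> {bs. length bs = n})"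
    by (force simp: length_Suc_conv image_iff)
  moreover have "inj_on (\<lambda>(b, bs :: 'a list). b # bs) (UNIV \<times> {bs. length bs = n})"
    by (auto simp: inj_on_def)
  ultimately show ?thesis
    by (simp add: sum.reindex sum.cartesian_product case_prod_unfold)
qed

lemma cmat_scale_sum_mult_left:
  assumes "finite S"
  shows "(\<Sum>x\<in>S. cmat_scale (c x) (f x)) ** M = (\<Sum>x\<in>S. cmat_scale (c x) (f x ** M))"
proof -
  have add: "(A + B) ** M = A ** M + B ** M" for A B
    by (simp add: vec_eq_iff matrix_matrix_mult_def distrib_right sum.distrib)
  have "cmat_scale a A ** M = cmat_scale a (A ** M)" for a A
    by (simp add: vec_eq_iff matrix_matrix_mult_def cmat_scale_def sum_distrib_left mult.assoc)
  with assms show ?thesis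
    by (induction S rule: finite_induct) (simp_all add: add)
qed

lemma cmat_scale_sum_mult_right:
  assumes "finite S"
  shows "M ** (\<Sum>x\<in>S. cmat_scale (c x) (f x)) = (\<Sum>x\<in>S. cmat_scale (c x) (M ** f x))"
proof -
  have "M ** cmat_scale a A = cmat_scale a (M ** A)" for a A
    by (simp add: vec_eq_iff matrix_matrix_mult_def cmat_scale_def sum_distrib_left mult.left_commute)
  with assms show ?thesis
    by (induction S rule: finite_induct) (simp_all add: matrix_add_ldistrib)
qed

lemma tensor_eval_sum:
  fixes X :: "'n::finite cmat"
  assumes "finite S"
  shows "tensor_eval X (\<Sum>x\<in>S. cmat_scale (c x) (f x)) Bs
       = (\<Sum>x\<in>S. cmat_scale (c x) (tensor_eval X (f x) Bs))"
proof (induction Bs rule: rev_induct)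
  case Nil
  then show ?case by (simp add: tensor_eval_def)
next
  case (snoc B Bs)
  have *: "(\<Sum>x\<in>S. cmat_scale (c x) (g x)) ** M = (\<Sum>x\<in>S. cmat_scale (c x) (g x ** M))"
    for g :: "_ \<Rightarrow> 'n cmat" and M
    by (rule cmat_scale_sum_mult_left[OF assms])
  from snoc show ?case
    by (simp add: tensor_eval_def *)
qed

lemma tensor_eval_expand:
  "(\<Sum>bs | length bs = length Bs. cmat_scale
      (\<Prod>k<length Bs. Bs ! k $ fst (bs ! k) $ snd (bs ! k)) (tensor_eval X M (map matrix_unit bs)))
   = tensor_eval X M Bs"
proof (induction Bs arbitrary: M)
  case Nil
  then show ?case by (simp add: tensor_eval_def cmat_scale_def vec_eq_iff)
next
  case (Cons B Bs)
  have te: "tensor_eval X M (C # Cs) = tensor_eval X (M ** X ** C) Cs" for C Cs M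
    by (simp add: tensor_eval_def)
  have mult: "M ** X ** B
      = (\<Sum>b\<in>UNIV. cmat_scale (B $ fst b $ snd b) (M ** X ** matrix_unit b))"
    by (subst matrix_expand[of B]) (rule cmat_scale_sum_mult_right, simp)
  have "(\<Sum>bs | length bs = length (B # Bs). cmat_scale
      (\<Prod>k<length (B # Bs). (B # Bs) ! k $ fst (bs ! k) $ snd (bs ! k))
        (tensor_eval X M (map matrix_unit bs)))
    = (\<Sum>b\<in>UNIV. cmat_scale (B $ fst b $ snd b) (\<Sum>bs | length bs = length Bs. cmat_scale
        (\<Prod>k<length Bs. Bs ! k $ fst (bs ! k) $ snd (bs ! k))
          (tensor_eval X (M ** X ** matrix_unit b) (map matrix_unit bs))))"
    by (simp add: lists_Suc_sum te cmat_scale_sum cmat_scale_cmat_scale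
        prod.lessThan_Suc_shift del: prod.lessThan_Suc)
  also have "\<dots> = tensor_eval X M (B # Bs)"
    by (simp add: Cons.IH te mult tensor_eval_sum)
  finally show ?case .
qed

lemma mp_eval_elem_tensor: "mp_eval (elem_tensor A Bs) X = tensor_eval X A Bs"
proof -
  let ?L = "{bs :: ('a \<times> 'a) list. length bs = length Bs}"
  have fin: "finite ?L"
    using finite_lists_length_eq[of "UNIV :: ('a \<times> 'a) set" "length Bs"] by simp
  have "Poly_Mapping.keys (elem_tensor A Bs) \<subseteq> UNIV \<times> ?L"
    by (auto simp: in_keys_iff elem_tensor.rep_eq split: if_splits)
  then have "mp_eval (elem_tensor A Bs) X = (\<Sum>(a, bs)\<in>UNIV \<times> ?L.
      cmat_scale (Poly_Mapping.lookup (elem_tensor A Bs) (a, bs))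
            (tensor_eval X (matrix_unit a) (map matrix_unit bs)))"
    using fin by (subst mp_eval_superset[of "UNIV \<times> ?L"]) (auto simp: case_prod_unfold)
  also have "\<dots> = (\<Sum>a\<in>UNIV. \<Sum>bs\<in>?L. cmat_scale (A $ fst a $ snd a) (cmat_scale
      (\<Prod>k<length Bs. Bs ! k $ fst (bs ! k) $ snd (bs ! k))
        (tensor_eval X (matrix_unit a) (map matrix_unit bs))))"
    by (simp add: elem_tensor.rep_eq cmat_scale_cmat_scale flip: sum.cartesian_product)
  also have "\<dots> = (\<Sum>a\<in>UNIV. cmat_scale (A $ fst a $ snd a) (tensor_eval X (matrix_unit a) Bs))"
    by (simp add: tensor_eval_expand flip: cmat_scale_sum)
  also have "\<dots> = tensor_eval X A Bs"
    using tensor_eval_sum[of "UNIV :: ('a \<times> 'a) set" X "\<lambda>a. A $ fst a $ snd a" matrix_unit Bs]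
    by (simp flip: matrix_expand)
  finally show ?thesis .
qed

lemma mp_star_add: "mp_star (p + q) = mp_star p + mp_star q"
  by (rule poly_mapping_eqI) (simp add: mp_star.rep_eq lookup_add)

lemma mp_star_scale: "mp_star (mp_scale c p) = mp_scale (cnj c) (mp_star p)"
  by (rule poly_mapping_eqI) (simp add: mp_star.rep_eq lookup_mp_scale)

lemma mp_star_star: "mp_star (mp_star p) = p"
  by (rule poly_mapping_eqI) (simp add: mp_star.rep_eq word_star_word_star)

lemma lookup_elem_tensor_Cons:
  "Poly_Mapping.lookup (elem_tensor (hd As) (tl As)) (hd ws, tl ws)
   = (if length ws = length As
      then \<Prod>k<length As. As ! k $ fst (ws ! k) $ snd (ws ! k) else 0)"
  if "As \<noteq> []" "ws \<noteq> []"
  using that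
  by (cases As; cases ws)
    (simp_all add: elem_tensor.rep_eq prod.lessThan_Suc_shift del: prod.lessThan_Suc)

lemma mp_star_elem_tensor:
  assumes "As \<noteq> []"
  shows "mp_star (elem_tensor (hd As) (tl As))
       = elem_tensor (hd (rev (map cadjoint As))) (tl (rev (map cadjoint As)))"
proof (rule poly_mapping_eqI)
  fix w :: "'a unit_word"
  define ws where "ws = fst w # snd w"
  have w: "w = (hd ws, tl ws)" and ws: "ws \<noteq> []" by (simp_all add: ws_def)
  have "word_star w = (hd (rev (map prod.swap ws)), tl (rev (map prod.swap ws)))"
    by (simp add: word_star_def ws_def Let_def)
  then have "Poly_Mapping.lookup (mp_star (elem_tensor (hd As) (tl As))) w
     = cnj (if length ws = length As
      then \<Prod>k<length As. As ! k $ fst (rev (map prod.swap ws) ! k) $ snd (rev (map prod.swap ws) ! k)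
      else 0)"
    using assms ws lookup_elem_tensor_Cons[of As "rev (map prod.swap ws)"]
    by (simp add: mp_star.rep_eq)
  also have "\<dots> = (if length ws = length As
      then \<Prod>k<length As. cnj (As ! k $ snd (ws ! (length As - Suc k)) $ fst (ws ! (length As - Suc k)))
      else 0)"
    by (auto simp: rev_nth intro!: prod.cong)
  also have "\<dots> = (if length ws = length As
      then \<Prod>k<length As. rev (map cadjoint As) ! k $ fst (ws ! k) $ snd (ws ! k)
      else 0)"
    by (subst prod.nat_diff_reindex[symmetric])
      (auto simp: rev_nth cadjoint_def Suc_diff_Suc intro!: prod.cong)
  also have "\<dots> = Poly_Mapping.lookup
      (elem_tensor (hd (rev (map cadjoint As))) (tl (rev (map cadjoint As)))) w"
    using assms ws lookup_elem_tensor_Cons[of "rev (map cadjoint As)" ws] by (simp add: w)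
  finally show "Poly_Mapping.lookup (mp_star (elem_tensor (hd As) (tl As))) w = \<dots>" .
qed

lemma elem_tensor_matrix_unit:
  "elem_tensor (matrix_unit a) (map matrix_unit bs) = Poly_Mapping.single (a, bs) 1"
proof (rule poly_mapping_eqI)
  fix w :: "'a unit_word"
  obtain c cs where w: "w = (c, cs)" by (cases w)
  have "(\<Prod>k<length bs. if cs ! k = bs ! k then 1 else 0 :: complex)
      = (if \<forall>k<length bs. cs ! k = bs ! k then 1 else 0)"
    by (auto intro!: prod_zero)
  then show "Poly_Mapping.lookup (elem_tensor (matrix_unit a) (map matrix_unit bs)) w
      = Poly_Mapping.lookup (Poly_Mapping.single (a, bs) 1) w"
    by (auto simp: w elem_tensor.rep_eq matrix_unit_def lookup_single when_def list_eq_iff_nth_eq)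
qed

lemma matpol_expand:
  "p = (\<Sum>w\<in>Poly_Mapping.keys p. mp_scale (Poly_Mapping.lookup p w)
          (elem_tensor (matrix_unit (fst w)) (map matrix_unit (snd w))))"
proof (rule poly_mapping_eqI)
  fix v
  show "Poly_Mapping.lookup p v = Poly_Mapping.lookup (\<Sum>w\<in>Poly_Mapping.keys p.
      mp_scale (Poly_Mapping.lookup p w)
          (elem_tensor (matrix_unit (fst w)) (map matrix_unit (snd w)))) v"
    by (simp add: lookup_sum lookup_mp_scale elem_tensor_matrix_unit lookup_single when_def
        if_distrib in_keys_iff cong: if_cong)
qed

lemma sphere_degree_eq:
  assumes hg: "homeomorphic_maps (nsphere m) S h g" and f: "continuous_map S S f"
  shows "sphere_degree m S f = Brouwer_degree2 m (g \<circ> f \<circ> h)"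
proof -
  have "Brouwer_degree2 m (g' \<circ> f \<circ> h') = Brouwer_degree2 m (g \<circ> f \<circ> h)"
    if hg': "homeomorphic_maps (nsphere m) S h' g'" for h' g'
  proof -
    have cont: "continuous_map (nsphere m) S h" "continuous_map S (nsphere m) g"
      "continuous_map (nsphere m) S h'" "continuous_map S (nsphere m) g'"
      using hg hg' by (auto simp: homeomorphic_maps_def)
    have c1: "continuous_map (nsphere m) (nsphere m) (g \<circ> f \<circ> h)"
      and c2: "continuous_map (nsphere m) (nsphere m) (g \<circ> h')"
      and c3: "continuous_map (nsphere m) (nsphere m) (g' \<circ> h)"
      using continuous_map_compose[OF cont(1) continuous_map_compose[OF f cont(2)]]
        continuous_map_compose[OF cont(3) cont(2)] continuous_map_compose[OF cont(1) cont(4)]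
      by (simp_all add: comp_assoc)
    have hs: "homeomorphic_maps (nsphere m) (nsphere m) (g \<circ> h') (g' \<circ> h)"
      using homeomorphic_maps_compose[OF conjI[OF hg' homeomorphic_maps_sym[THEN iffD1, OF hg]]] .
    have "Brouwer_degree2 m (g' \<circ> f \<circ> h')
        = Brouwer_degree2 m ((g' \<circ> h) \<circ> ((g \<circ> f \<circ> h) \<circ> (g \<circ> h')))"
    proof (rule Brouwer_degree2_eq)
      fix x assume x: "x \<in> topspace (nsphere m)"
      then have "h' x \<in> topspace S" "f (h' x) \<in> topspace S"
        using cont(3) f by (auto simp: continuous_map_def Pi_iff)
      then show "(g' \<circ> f \<circ> h') x = ((g' \<circ> h) \<circ> ((g \<circ> f \<circ> h) \<circ> (g \<circ> h'))) x"
        using hg by (simp add: homeomorphic_maps_def)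
    qed
    also have "\<dots> = Brouwer_degree2 m (g' \<circ> h) *
        (Brouwer_degree2 m (g \<circ> f \<circ> h) * Brouwer_degree2 m (g \<circ> h'))"
      using c1 c2 c3 by (simp add: Brouwer_degree2_compose continuous_map_compose)
    also have "\<dots> = Brouwer_degree2 m (g \<circ> f \<circ> h)"
    proof -
      have "Brouwer_degree2 m ((g' \<circ> h) \<circ> (g \<circ> h')) = Brouwer_degree2 m id"
        using hs by (intro Brouwer_degree2_eq) (simp add: homeomorphic_maps_def)
      then have "Brouwer_degree2 m (g' \<circ> h) * Brouwer_degree2 m (g \<circ> h') = 1"
        using c2 c3 by (simp add: Brouwer_degree2_compose)
      then show ?thesis
        by (simp add: mult.left_commute)
    qed
    finally show ?thesis .
  qed
  then show ?thesis
    unfolding sphere_degree_def using hg by blast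
qed

text \<open>The real matrix A corresponds to the Hermitian matrix whose real part is the symmetric
  and whose imaginary part is the antisymmetric part of A; this is an isometry.\<close>

lemma herm_sphere_homeomorphic:
  "\<exists>h g. homeomorphic_maps (nsphere (CARD('n)\<^sup>2 - 1)) (herm_sphere :: 'n::finite cmat topology) h g"
proof -
  define s where "s = sqrt (real CARD('n))"
  have s: "s > 0" "s\<^sup>2 = real CARD('n)" by (simp_all add: s_def)
  define T :: "real^'n^'n \<Rightarrow> 'n cmat"
    where "T A = (\<chi> i j. Complex (s * (A$i$j + A$j$i) / 2) (s * (A$i$j - A$j$i) / 2))" for A
  define R :: "'n cmat \<Rightarrow> real^'n^'n"
    where "R X = (\<chi> i j. (Re (X$i$j) + Im (X$i$j)) / s)" for X
  have herm: "hermitian (T A)" for A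
    by (simp add: hermitian_def cadjoint_def T_def vec_eq_iff complex_eq_iff algebra_simps
        diff_divide_distrib add_divide_distrib)
  have RT: "R (T A) = A" for A
    using s by (simp add: R_def T_def vec_eq_iff field_simps)
  have TR: "T (R X) = X" if "hermitian X" for X
  proof -
    have "Re (X $ j $ i) = Re (X $ i $ j)" "Im (X $ j $ i) = - Im (X $ i $ j)" for i j
      using that by (metis (no_types, lifting) cadjoint_def cnj.simps hermitian_def vec_lambda_beta)+
    note * = this[of _ _]
    have "(T (R X)) $ i $ j = X $ i $ j" for i j
      using s *[of i j] by (simp add: R_def T_def complex_eq_iff field_simps)
    then show ?thesis by (simp add: vec_eq_iff)
  qed
  have normA: "(norm A)\<^sup>2 = (\<Sum>i\<in>UNIV. \<Sum>j\<in>UNIV. (A$i$j)\<^sup>2)" for A :: "real^'n^'n"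
    by (simp add: norm_vec_def L2_set_def sum_nonneg)
  have nT: "cmat_norm (T A) = norm A" for A
  proof -
    have e: "(cmod (T A $ i $ j))\<^sup>2 = s\<^sup>2 * ((A$i$j)\<^sup>2 + (A$j$i)\<^sup>2) / 2" for i j
      by (simp add: T_def cmod_power2) (simp add: power2_eq_square field_simps)
    have "(\<Sum>i\<in>UNIV. \<Sum>j\<in>UNIV. (cmod (T A $ i $ j))\<^sup>2)
        = s\<^sup>2 * ((\<Sum>i\<in>UNIV. \<Sum>j\<in>UNIV. (A$i$j)\<^sup>2) + (\<Sum>i\<in>UNIV. \<Sum>j\<in>UNIV. (A$j$i)\<^sup>2)) / 2"
      by (simp only: e sum.distrib[symmetric] sum_distrib_left sum_divide_distrib)
    also have "(\<Sum>i\<in>UNIV. \<Sum>j\<in>UNIV. (A$j$i)\<^sup>2) = (\<Sum>i\<in>UNIV. \<Sum>j\<in>UNIV. (A$i$j)\<^sup>2)"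
      by (rule sum.swap)
    finally have "(\<Sum>i\<in>UNIV. \<Sum>j\<in>UNIV. (cmod (T A $ i $ j))\<^sup>2) = real CARD('n) * (norm A)\<^sup>2"
      using s by (simp add: normA)
    then show ?thesis by (simp add: cmat_norm_def)
  qed
  have contT: "continuous_on UNIV T"
    unfolding T_def Complex_eq by (intro continuous_intros) auto
  have contR: "continuous_on UNIV R"
    unfolding R_def using s by (intro continuous_intros) auto
  have homTR: "homeomorphic_maps (top_of_set (sphere 0 1)) herm_sphere T R"
    unfolding homeomorphic_maps_def herm_sphere_def
  proof (intro conjI ballI)
    show "continuous_map (top_of_set (sphere 0 1)) (top_of_set {X. hermitian X \<and> cmat_norm X = 1}) T"
      using contT by (auto simp: herm nT intro: continuous_on_subset)
    show "continuous_map (top_of_set {X. hermitian X \<and> cmat_norm X = 1}) (top_of_set (sphere 0 1)) R"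
      using contR by (auto simp: TR nT[symmetric] intro: continuous_on_subset)
  qed (auto simp: RT TR)
  have card: "card (Basis :: (real^'n^'n) set) = CARD('n)\<^sup>2"
    by (simp add: power2_eq_square)
  obtain h g where "homeomorphic_maps (nsphere (CARD('n)\<^sup>2 - 1))
      (top_of_set (sphere (0 :: real^'n^'n) 1 \<inter> span Basis)) h g"
    using homeomorphic_maps_nsphere_euclidean_sphere
      [OF independent_Basis orthogonal_Basis card _ norm_Basis] by auto
  then have "homeomorphic_maps (nsphere (CARD('n)\<^sup>2 - 1)) herm_sphere (T \<circ> h) (g \<circ> R)"
    using homTR by (auto intro: homeomorphic_maps_compose)
  then show ?thesis by blast
qed

end

(* If p had no Hermitian zero, then the maps X |-> t^d p(X/t) for t in (0,1], which extend by the
   leading form at t = 0, would normalize to a homotopy from the leading form to p on the sphere,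
   and X |-> p(sX) for s in [0,1] would further contract p to a constant map, which has degree 0. *)

theory Submission
  imports Defs
begin

section \<open>Adjoints, Hermitian matrices and the norm\<close>

lemma cadjoint_matrix_mult: "cadjoint (A ** B) = cadjoint B ** cadjoint A"
  by (simp add: cadjoint_def matrix_matrix_mult_def vec_eq_iff mult.commute)

lemma cadjoint_sum: "cadjoint (\<Sum>x\<in>S. f x) = (\<Sum>x\<in>S. cadjoint (f x))"
  by (simp add: cadjoint_def vec_eq_iff)

lemma cadjoint_scaleR: "cadjoint (r *\<^sub>R A) = r *\<^sub>R cadjoint A"
  by (simp add: cadjoint_def vec_eq_iff)

lemma cadjoint_cmat_scale: "cadjoint (cmat_scale c A) = cmat_scale (cnj c) (cadjoint A)"
  by (simp add: cadjoint_def cmat_scale_def vec_eq_iff)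

lemma cadjoint_matrix_unit: "cadjoint (matrix_unit a) = matrix_unit (prod.swap a)"
  by (cases a) (auto simp: cadjoint_def matrix_unit_def vec_eq_iff)

lemma hermitian_scaleR: "hermitian A \<Longrightarrow> hermitian (r *\<^sub>R A)"
  by (simp add: hermitian_def cadjoint_scaleR)

lemma hermitian_sum: "(\<And>x. x \<in> S \<Longrightarrow> hermitian (f x)) \<Longrightarrow> hermitian (\<Sum>x\<in>S. f x)"
  by (simp add: hermitian_def cadjoint_sum)

text \<open>The library norm on nested vectors is the Frobenius norm, so definiteness, scaling and
  continuity carry over from it.\<close>

lemma cmat_norm_eq_norm:
  fixes X :: "'n::finite cmat"
  shows "cmat_norm X = norm X / sqrt (real CARD('n))"
  by (simp add: cmat_norm_def norm_vec_def L2_set_def sum_nonneg real_sqrt_divide)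

lemma cmat_norm_eq_0: "cmat_norm X = 0 \<longleftrightarrow> X = 0"
  by (simp add: cmat_norm_eq_norm)

lemma cmat_norm_scaleR: "cmat_norm (r *\<^sub>R X) = \<bar>r\<bar> * cmat_norm X"
  by (simp add: cmat_norm_eq_norm)

lemma continuous_on_cmat_norm [continuous_intros]:
  "continuous_on S f \<Longrightarrow> continuous_on S (\<lambda>x. cmat_norm (f x))"
  unfolding cmat_norm_eq_norm by (intro continuous_intros) auto

lemma continuous_on_matrix_mult [continuous_intros]:
  fixes f g :: "_ \<Rightarrow> 'n::finite cmat"
  shows "continuous_on S f \<Longrightarrow> continuous_on S g \<Longrightarrow> continuous_on S (\<lambda>x. f x ** g x)"
  unfolding matrix_matrix_mult_def by (intro continuous_intros)

section \<open>Evaluation: adjoints, scaling, continuity\<close>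

lemma tensor_eval_snoc: "tensor_eval X A (Bs @ [C]) = tensor_eval X A Bs ** X ** C"
  by (simp add: tensor_eval_def)

text \<open>A left fold unfolds directly only at its right end; associativity gives the left end.
  The adjoint exchanges the two ends, so both forms are needed.\<close>

lemma tensor_eval_Cons: "tensor_eval X C (B # Bs) = C ** X ** tensor_eval X B Bs"
proof (induction Bs rule: rev_induct)
  case Nil
  then show ?case by (simp add: tensor_eval_def)
next
  case (snoc D Bs)
  then show ?case
    by (metis append_Cons matrix_mul_assoc tensor_eval_snoc)
qed

text \<open>The adjoint reverses products: the last factor, split off by
  \<open>tensor_eval_snoc\<close>, comes back as the first one through
  \<open>tensor_eval_Cons\<close>. The reversed word is named \<open>C # Cs\<close> because
  \<open>tensor_eval\<close> takes its first factor separately.\<close>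

lemma cadjoint_tensor_eval:
  assumes "rev (map cadjoint (A # Bs)) = C # Cs"
  shows "cadjoint (tensor_eval X A Bs) = tensor_eval (cadjoint X) C Cs"
  using assms
proof (induction Bs arbitrary: C Cs rule: rev_induct)
  case Nil
  then show ?case by (simp add: tensor_eval_def)
next
  case (snoc B Bs)
  obtain D Ds where D: "rev (map cadjoint (A # Bs)) = D # Ds"
    by (metis Nil_is_map_conv list.exhaust list.simps(3) rev_is_Nil_conv)
  with snoc.prems have "C = cadjoint B" "Cs = D # Ds" by auto
  with snoc.IH[OF D] show ?case
    by (simp add: tensor_eval_snoc tensor_eval_Cons cadjoint_matrix_mult matrix_mul_assoc)
qed

lemma cmat_mult_scaleR:
  fixes A B :: "'n::finite cmat"
  shows "(r *\<^sub>R A) ** B = r *\<^sub>R (A ** B)" "A ** (r *\<^sub>R B) = r *\<^sub>R (A ** B)"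
  by (simp_all add: matrix_matrix_mult_def vec_eq_iff scaleR_sum_right)

lemma tensor_eval_scaleR: "tensor_eval (r *\<^sub>R X) A Bs = r ^ length Bs *\<^sub>R tensor_eval X A Bs"
proof (induction Bs rule: rev_induct)
  case Nil
  then show ?case by (simp add: tensor_eval_def)
next
  case (snoc B Bs)
  then show ?case by (simp add: tensor_eval_snoc cmat_mult_scaleR)
qed

lemma continuous_on_tensor_eval [continuous_intros]:
  "continuous_on S f \<Longrightarrow> continuous_on S (\<lambda>x. tensor_eval (f x) A Bs)"
  by (induction Bs rule: rev_induct)
    (auto simp: tensor_eval_snoc tensor_eval_def[of _ _ "[]"] intro!: continuous_intros)

text \<open>Since \<open>word_star\<close> is an involution on words, it reindexes the sum over the
  support of \<open>p\<close> as a sum over the support of \<open>mp_star p\<close>; conjugated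
  coefficients then match term by term.\<close>

lemma cadjoint_mp_eval: "cadjoint (mp_eval p X) = mp_eval (mp_star p) (cadjoint X)"
proof -
  let ?T = "\<lambda>X w. tensor_eval X (matrix_unit (fst w)) (map matrix_unit (snd w))"
  have T: "cadjoint (?T X w) = ?T (cadjoint X) (word_star w)" for w :: "'a unit_word"
  proof (rule cadjoint_tensor_eval)
    \<comment> \<open>\<open>v\<close> is the starred word as a single list;
      \<open>word_star w\<close> splits it into head and tail.\<close>
    define v where "v = rev (map prod.swap (fst w # snd w))"
    have v: "v \<noteq> []" "word_star w = (hd v, tl v)"
      by (simp_all add: v_def word_star_def Let_def)
    have "rev (map cadjoint (matrix_unit (fst w) # map matrix_unit (snd w))) = map matrix_unit v"
      by (simp add: v_def cadjoint_matrix_unit flip: rev_map)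
    also have "\<dots> = map matrix_unit (hd v # tl v)"
      by (simp only: list.collapse[OF v(1)])
    finally show "rev (map cadjoint (matrix_unit (fst w) # map matrix_unit (snd w)))
        = matrix_unit (fst (word_star w)) # map matrix_unit (snd (word_star w))"
      by (simp add: v(2))
  qed
  have "Poly_Mapping.keys (mp_star p) = word_star ` Poly_Mapping.keys p"
    by (force simp: in_keys_iff mp_star.rep_eq word_star_word_star image_iff)
  then show ?thesis
    by (simp add: mp_eval_def sum.reindex inj_on_subset[OF inj_word_star] cadjoint_sum
        cadjoint_cmat_scale T mp_star.rep_eq word_star_word_star)
qed

lemma hermitian_mp_eval:
  assumes "mp_selfadjoint p" "hermitian X"
  shows "hermitian (mp_eval p X)"
  using assms by (simp add: hermitian_def mp_selfadjoint_def cadjoint_mp_eval)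

lemma continuous_on_mp_eval [continuous_intros]:
  "continuous_on S f \<Longrightarrow> continuous_on S (\<lambda>x. mp_eval p (f x))"
  unfolding mp_eval_def cmat_scale_def by (intro continuous_intros)

section \<open>The grading and the degree\<close>

lemma mp_selfadjoint_component:
  assumes "mp_selfadjoint p"
  shows "mp_selfadjoint (mp_component k p)"
proof -
  have "cnj (Poly_Mapping.lookup p (word_star w)) = Poly_Mapping.lookup p w" for w
    using assms by (metis mp_selfadjoint_def mp_star.rep_eq)
  \<comment> \<open>The involution keeps the number of tensor factors, so it respects the
    grading.\<close>
  moreover have "length (snd (word_star w)) = length (snd w)" for w :: "'a unit_word"
    by (simp add: word_star_def Let_def)
  ultimately show ?thesis
    by (simp add: mp_selfadjoint_def poly_mapping_eq_iff fun_eq_iff mp_star.rep_eq mp_component.rep_eq)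
qed

text \<open>In a word whose \<open>snd\<close> has length \<open>k\<close>, evaluation inserts
  \<open>X\<close> exactly \<open>k\<close> times.\<close>

lemma mp_eval_component_scaleR:
  "mp_eval (mp_component k p) (r *\<^sub>R X) = r ^ k *\<^sub>R mp_eval (mp_component k p) X"
proof -
  have "length (snd w) = k" if "w \<in> Poly_Mapping.keys (mp_component k p)" for w
    using that by (auto simp: in_keys_iff mp_component.rep_eq split: if_splits)
  then show ?thesis
    by (simp add: mp_eval_def tensor_eval_scaleR scaleR_sum_right cmat_scale_def vec_eq_iff)
qed

text \<open>The finite support of \<open>p\<close> leaves only finitely many non-zero components, so
  the \<open>Max\<close> in \<open>mp_degree\<close> is a genuine maximum.\<close>

lemma mp_degree_keys:
  assumes "mp_degree p = ereal (real d)" "w \<in> Poly_Mapping.keys p"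
  shows "length (snd w) \<le> d"
proof -
  let ?D = "{k. mp_component k p \<noteq> 0}"
  have "\<exists>w\<in>Poly_Mapping.keys p. k = length (snd w)" if nz: "mp_component k p \<noteq> 0" for k
  proof -
    obtain w where "Poly_Mapping.lookup (mp_component k p) w \<noteq> 0"
      using nz by (metis lookup_zero poly_mapping_eqI)
    then show ?thesis
      by (intro bexI[of _ w]) (auto simp: mp_component.rep_eq in_keys_iff split: if_splits)
  qed
  then have "?D \<subseteq> (length \<circ> snd) ` Poly_Mapping.keys p" by auto
  then have "finite ?D" by (rule finite_subset) simp
  \<comment> \<open>A finite degree excludes \<open>p = 0\<close>, whose degree is
    -\<infinity>.\<close>
  moreover have "d = Max ?D" using assms(1) by (simp add: mp_degree_def split: if_splits)
  moreover have "Poly_Mapping.lookup (mp_component (length (snd w)) p) w \<noteq> 0"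
    using assms(2) by (simp add: mp_component.rep_eq in_keys_iff)
  then have "length (snd w) \<in> ?D" by auto
  ultimately show ?thesis by simp
qed

lemma mp_eval_eq_sum_components:
  assumes "mp_degree p = ereal (real d)"
  shows "mp_eval p X = (\<Sum>k\<le>d. mp_eval (mp_component k p) X)"
proof -
  have "mp_eval (\<Sum>k\<in>K. mp_component k p) X = (\<Sum>k\<in>K. mp_eval (mp_component k p) X)"
    if "finite K" for K
    using that by induction (simp_all add: mp_eval_add mp_eval_def[of 0])
  moreover have "p = (\<Sum>k\<le>d. mp_component k p)"
    using mp_degree_keys[OF assms]
    by (force simp: poly_mapping_eq_iff fun_eq_iff lookup_sum mp_component.rep_eq in_keys_iff)
  ultimately show ?thesis by (metis finite_atMost)
qed

section \<open>Homotopies and degree on the Hermitian sphere\<close>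

lemma homotopic_normalize_herm:
  fixes G :: "real \<Rightarrow> 'n::finite cmat \<Rightarrow> 'n cmat"
  assumes cont: "continuous_on UNIV (\<lambda>z. G (fst z) (snd z))"
    and herm: "\<And>t X. hermitian X \<Longrightarrow> hermitian (G t X)"
    and nz: "\<And>t X. \<lbrakk>0 \<le> t; t \<le> 1; hermitian X; cmat_norm X = 1\<rbrakk> \<Longrightarrow> G t X \<noteq> 0"
  shows "homotopic_with (\<lambda>_. True) herm_sphere herm_sphere
    (\<lambda>X. (1 / cmat_norm (G 0 X)) *\<^sub>R G 0 X) (\<lambda>X. (1 / cmat_norm (G 1 X)) *\<^sub>R G 1 X)"
proof -
  let ?S = "{X :: 'n cmat. hermitian X \<and> cmat_norm X = 1}"
  define H where "H z = (1 / cmat_norm (G (fst z) (snd z))) *\<^sub>R G (fst z) (snd z)" for z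
  \<comment> \<open>This makes the division in \<open>H\<close> continuous; its factor is real, so
    values stay Hermitian.\<close>
  have nz': "cmat_norm (G t X) \<noteq> 0" if "t \<in> {0..1}" "X \<in> ?S" for t X
    using nz[of t X] that by (simp add: cmat_norm_eq_0)
  have "continuous_on ({0..1} \<times> ?S) H"
    unfolding H_def using nz'
    by (intro continuous_intros continuous_on_subset[OF cont]) auto
  moreover have "H \<in> {0..1} \<times> ?S \<rightarrow> ?S"
    using nz' by (auto simp: H_def hermitian_scaleR herm cmat_norm_scaleR)
      (metis (no_types) abs_of_nonneg cmat_norm_eq_norm divide_nonneg_nonneg norm_ge_zero
        of_nat_0_le_iff real_sqrt_ge_zero)
  ultimately show ?thesis
    unfolding homotopic_with_def herm_sphere_def
    by (intro exI[of _ H]) (auto simp: H_def)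
qed

text \<open>Conjugating the homotopy by a homeomorphism moves it to the standard sphere, where the
  degree is homotopy invariant and constant maps have degree 0. This includes the sphere of
  dimension 0, as the degree there uses reduced homology.\<close>

lemma herm_sphere_degree_homotopic_const:
  fixes f :: "'n::finite cmat \<Rightarrow> 'n cmat"
  assumes "homotopic_with (\<lambda>_. True) herm_sphere herm_sphere f (\<lambda>_. c)"
  shows "herm_sphere_degree f = 0"
proof -
  let ?N = "nsphere (CARD('n)\<^sup>2 - 1)"
  obtain h g where hg: "homeomorphic_maps ?N (herm_sphere :: 'n cmat topology) h g"
    using herm_sphere_homeomorphic by blast
  have h: "continuous_map ?N herm_sphere h" and g: "continuous_map herm_sphere ?N g"
    using hg by (auto simp: homeomorphic_maps_def)
  \<comment> \<open>Continuity of \<open>f\<close>, required by \<open>sphere_degree_eq\<close>, is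
    part of being homotopic to another map.\<close>
  have "continuous_map herm_sphere herm_sphere f"
    using assms by (rule homotopic_with_imp_continuous_maps[THEN conjunct1])
  then have "herm_sphere_degree f = Brouwer_degree2 (CARD('n)\<^sup>2 - 1) (g \<circ> f \<circ> h)"
    unfolding herm_sphere_degree_def by (rule sphere_degree_eq[OF hg])
  also have "homotopic_with (\<lambda>_. True) ?N ?N (g \<circ> f \<circ> h) (g \<circ> (\<lambda>_. c) \<circ> h)"
    by (intro homotopic_with_compose_continuous_map_right[OF _ h]
        homotopic_with_compose_continuous_map_left[OF assms g]) simp_all
  then have "Brouwer_degree2 (CARD('n)\<^sup>2 - 1) (g \<circ> f \<circ> h)
      = Brouwer_degree2 (CARD('n)\<^sup>2 - 1) (\<lambda>_. g c)"
    by (simp add: Brouwer_degree2_homotopic o_def)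
  also have "\<dots> = 0"
    by (rule Brouwer_degree2_const)
  finally show ?thesis .
qed

theorem theorem1:
  fixes p :: "'n::finite matpol" and d :: nat
  assumes "mp_selfadjoint p"
    and "mp_degree p = ereal (real d)"
    and "mp_nondegenerate (mp_component d p)"
    and "herm_sphere_degree (sphere_map (mp_component d p)) \<noteq> 0"
  shows "\<exists>X. hermitian X \<and> mp_eval p X = 0"
proof (rule ccontr)
  assume contr: "\<not> ?thesis"
  let ?q = "\<lambda>k. mp_eval (mp_component k p)"
  have herm: "hermitian (?q k X)" if "hermitian X" for k X
    using that by (intro hermitian_mp_eval mp_selfadjoint_component assms(1))
  \<comment> \<open>This is \<open>t ^ d\<close> times the value of \<open>p\<close> at
    \<open>X / t\<close>, with the division cleared: the component of degree \<open>k\<close>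
    contributes the factor \<open>t ^ (d - k)\<close>, which also makes sense at
    \<open>t = 0\<close>.\<close>
  define P where "P t X = (\<Sum>k\<le>d. t ^ (d - k) *\<^sub>R ?q k X)" for t X
  \<comment> \<open>Only \<open>k = d\<close> survives, since \<open>0 ^ 0 = 1\<close>.\<close>
  have P0: "P 0 = ?q d"
    by (simp add: P_def fun_eq_iff power_0_left if_distrib[of "\<lambda>r. r *\<^sub>R _"] cong: if_cong)
  have P1: "P 1 = mp_eval p"
    by (simp add: P_def fun_eq_iff mp_eval_eq_sum_components[OF assms(2)])
  have scale: "P t X = t ^ d *\<^sub>R mp_eval p ((1 / t) *\<^sub>R X)" if "t > 0" for t X
    using that by (simp add: P_def mp_eval_eq_sum_components[OF assms(2)] mp_eval_component_scaleR
        scaleR_sum_right power_diff power_inverse divide_inverse)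
  have "homotopic_with (\<lambda>_. True) herm_sphere herm_sphere
      (\<lambda>X. (1 / cmat_norm (P 0 X)) *\<^sub>R P 0 X) (\<lambda>X. (1 / cmat_norm (P 1 X)) *\<^sub>R P 1 X)"
  proof (rule homotopic_normalize_herm)
    show "continuous_on UNIV (\<lambda>z. P (fst z) (snd z))"
      unfolding P_def by (intro continuous_intros)
    show "hermitian (P t X)" if "hermitian X" for t X
      unfolding P_def using that by (intro hermitian_sum hermitian_scaleR herm)
    \<comment> \<open>At \<open>t = 0\<close> this is non-degeneracy, as \<open>X\<close> has norm 1
      and is thus non-zero. For \<open>t > 0\<close> a zero would make \<open>X / t\<close> a
      Hermitian zero of \<open>p\<close>.\<close>
    show "P t X \<noteq> 0" if "0 \<le> t" "hermitian X" "cmat_norm X = 1" for t X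
    proof (cases "t = 0")
      case True
      have "X \<noteq> 0" using that(3) by (auto simp: cmat_norm_eq_norm)
      with True that(2) assms(3) show ?thesis by (auto simp: P0 mp_nondegenerate_def)
    next
      case False
      with that contr show ?thesis by (auto simp: scale hermitian_scaleR)
    qed
  qed
  \<comment> \<open>Shrinking the argument by \<open>1 - t\<close> leads from \<open>p\<close> to
    the constant \<open>p\<close> at 0. The terms \<open>1 - 0\<close> and \<open>1 - 1\<close> stay
    unsimplified to match \<open>G 0\<close> and \<open>G 1\<close> in the rule.\<close>
  moreover have "homotopic_with (\<lambda>_. True) herm_sphere herm_sphere
      (\<lambda>X. (1 / cmat_norm (mp_eval p ((1 - 0) *\<^sub>R X))) *\<^sub>R mp_eval p ((1 - 0) *\<^sub>R X))
      (\<lambda>X. (1 / cmat_norm (mp_eval p ((1 - 1) *\<^sub>R X))) *\<^sub>R mp_eval p ((1 - 1) *\<^sub>R X))"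
    by (rule homotopic_normalize_herm[where G = "\<lambda>t X. mp_eval p ((1 - t) *\<^sub>R X)"])
      (use contr in \<open>auto intro!: continuous_intros hermitian_mp_eval hermitian_scaleR assms(1)\<close>)
  \<comment> \<open>The two homotopies join at the normalization of \<open>mp_eval p\<close>, which
    is both \<open>P 1\<close> and the start of the shrinking.\<close>
  ultimately have "homotopic_with (\<lambda>_. True) herm_sphere herm_sphere (sphere_map (mp_component d p))
      (\<lambda>X. (1 / cmat_norm (mp_eval p 0)) *\<^sub>R mp_eval p 0)"
    unfolding P0 P1 sphere_map_def by (simp add: homotopic_with_trans)
  then have "herm_sphere_degree (sphere_map (mp_component d p)) = 0"
    by (rule herm_sphere_degree_homotopic_const)
  with assms(4) show False by contradiction
qed

end
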